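(* Let $G$ be a $\mathbf{W}$-object. For any $f\in G$, $\bigvee^\bullet_{n\in\mathbb{N}} (f\wedge n) = f$, i.e., $f$ is the pointwise supremum of its truncates $\{f\wedge n : n\in\mathbb{N}\}$.
   Context: $\mathbf{W}$ is the category of archimedean lattice-ordered groups $G$ with a designated weak order unit, written $1$ (so $1\ge 0$ and $g \wedge 1 = 0$ with $g \geq 0$ implies $g = 0$); morphisms are lattice-ordered group homomorphisms carrying designated unit to designated unit. Here $n$ also denotes the multiple $n\cdot 1\in G$ of the unit, for positive integers $n$. For $F\subseteq G$ and $f_0\in G$, $f_0$ is the pointwise supremum of $F$ in $G$, written $f_0=\bigvee^\bullet F$, if $\theta(f_0) = \bigvee \theta[F]$ in $H$ for every $\mathbf{W}$-morphism $\theta: G\to H$. *)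

theory Defs
  imports "HOL-Algebra.Algebra"
begin

(* The group operation is written multiplicatively, following HOL-Algebra, and is not assumed
   commutative. The additive notions g + h, 0, n g of lattice-ordered group theory are
   g \<otimes> h, \<one>, g [^] n here. In particular \<one> is the neutral element (the additive 0);
   the designated weak order unit (usually written 1) is the separate record field wunit. *)

record 'a ulgroup = "'a monoid" +
  lle :: "'a \<Rightarrow> 'a \<Rightarrow> bool"
  wunit :: 'a

definition order_of :: "('a, 'b) ulgroup_scheme \<Rightarrow> 'a gorder" where
  "order_of G = \<lparr>carrier = carrier G, eq = (=), le = lle G\<rparr>"

locale l_group = group G + ord: lattice "order_of G"
  for G :: "('a, 'b) ulgroup_scheme" (structure) +
  assumes mult_left_mono:
      "\<lbrakk>x \<in> carrier G; y \<in> carrier G; z \<in> carrier G; lle G x y\<rbrakk> \<Longrightarrow> lle G (z \<otimes> x) (z \<otimes> y)"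
    and mult_right_mono:
      "\<lbrakk>x \<in> carrier G; y \<in> carrier G; z \<in> carrier G; lle G x y\<rbrakk> \<Longrightarrow> lle G (x \<otimes> z) (y \<otimes> z)"

locale archimedean_l_group = l_group +
  assumes archimedean:
    "\<lbrakk>a \<in> carrier G; b \<in> carrier G; lle G \<one> a; \<forall>n::nat. lle G (a [^] n) b\<rbrakk> \<Longrightarrow> a = \<one>"

locale W_object = archimedean_l_group +
  assumes wunit_closed: "wunit G \<in> carrier G"
    and wunit_nonneg: "lle G \<one> (wunit G)"
    and wunit_weak:
      "\<lbrakk>g \<in> carrier G; lle G \<one> g; g \<sqinter>\<^bsub>order_of G\<^esub> wunit G = \<one>\<rbrakk> \<Longrightarrow> g = \<one>"

definition W_hom :: "('a, 'c) ulgroup_scheme \<Rightarrow> ('b, 'd) ulgroup_scheme \<Rightarrow> ('a \<Rightarrow> 'b) set" where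
  "W_hom G H = {\<theta> \<in> hom G H.
     (\<forall>x\<in>carrier G. \<forall>y\<in>carrier G.
        \<theta> (x \<squnion>\<^bsub>order_of G\<^esub> y) = \<theta> x \<squnion>\<^bsub>order_of H\<^esub> \<theta> y \<and>
        \<theta> (x \<sqinter>\<^bsub>order_of G\<^esub> y) = \<theta> x \<sqinter>\<^bsub>order_of H\<^esub> \<theta> y) \<and>
     \<theta> (wunit G) = wunit H}"

(* HOL cannot quantify over types inside a definition, so the codomains H range over all W-objects
   with elements in the type passed as argument. A theorem concluding pointwise_sup TYPE('h) with
   'h a free type variable covers every W-object H. *)
definition pointwise_sup ::
    "'h itself \<Rightarrow> 'a ulgroup \<Rightarrow> 'a set \<Rightarrow> 'a \<Rightarrow> bool" where
  "pointwise_sup _ G F f0 \<longleftrightarrow> F \<subseteq> carrier G \<and> f0 \<in> carrier G \<and>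
     (\<forall>H :: 'h ulgroup. \<forall>\<theta>. W_object H \<longrightarrow> \<theta> \<in> W_hom G H \<longrightarrow>
        least (order_of H) (\<theta> f0) (Upper (order_of H) (\<theta> ` F)))"

end

theory Submission
  imports Defs
begin

text \<open>A \<open>\<^bold>W\<close>-morphism maps the truncates of \<open>f\<close> to the truncates of its image, so it suffices that in every
  \<open>\<^bold>W\<close>-object each \<open>f\<close> is the supremum of its truncates. Additively, with unit \<open>u\<close>: if \<open>h\<close> bounds
  all \<open>f \<and> n u\<close>, then \<open>a = f - (f \<and> h) \<ge> 0\<close> satisfies \<open>a \<le> (f - n u)\<^sup>+\<close> for all \<open>n\<close>. For
  \<open>b = a \<and> u\<close>, induction on \<open>k\<close> gives \<open>k b \<le> (f - n u)\<^sup>+\<close> for all \<open>n\<close>, because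
  \<open>(f - (n + 1) u)\<^sup>+ + b \<le> (f - n u) \<or> b \<le> (f - n u)\<^sup>+\<close>. Hence \<open>b = 0\<close> by the
  archimedean property, and \<open>a = 0\<close> since \<open>u\<close> is a weak unit.\<close>

lemma carrier_order_of [simp]: "carrier (order_of G) = carrier G"
  and le_order_of [simp]: "le (order_of G) = lle G"
  and eq_order_of [simp]: "eq (order_of G) = (=)"
  by (simp_all add: order_of_def)

context l_group
begin

lemma lle_trans:
  "\<lbrakk>lle G x y; lle G y z; x \<in> carrier G; y \<in> carrier G; z \<in> carrier G\<rbrakk> \<Longrightarrow> lle G x z"
  using ord.le_trans[of x y z] by simp

lemma meet_in_carrier [simp]:
  "\<lbrakk>x \<in> carrier G; y \<in> carrier G\<rbrakk> \<Longrightarrow> x \<sqinter>\<^bsub>order_of G\<^esub> y \<in> carrier G"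
  using ord.meet_closed[of x y] by simp

lemma join_in_carrier [simp]:
  "\<lbrakk>x \<in> carrier G; y \<in> carrier G\<rbrakk> \<Longrightarrow> x \<squnion>\<^bsub>order_of G\<^esub> y \<in> carrier G"
  using ord.join_closed[of x y] by simp

lemma meet_lower:
  assumes "x \<in> carrier G" "y \<in> carrier G"
  shows meet_lower1: "lle G (x \<sqinter>\<^bsub>order_of G\<^esub> y) x"
    and meet_lower2: "lle G (x \<sqinter>\<^bsub>order_of G\<^esub> y) y"
  using ord.meet_left[of x y] ord.meet_right[of x y] assms by simp_all

lemma meet_greatest:
  "\<lbrakk>lle G z x; lle G z y; x \<in> carrier G; y \<in> carrier G; z \<in> carrier G\<rbrakk>
    \<Longrightarrow> lle G z (x \<sqinter>\<^bsub>order_of G\<^esub> y)"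
  using ord.meet_le[of z x y] by simp

lemma join_upper:
  assumes "x \<in> carrier G" "y \<in> carrier G"
  shows join_upper1: "lle G x (x \<squnion>\<^bsub>order_of G\<^esub> y)"
    and join_upper2: "lle G y (x \<squnion>\<^bsub>order_of G\<^esub> y)"
  using ord.join_left[of x y] ord.join_right[of x y] assms by simp_all

lemma join_least:
  "\<lbrakk>lle G x z; lle G y z; x \<in> carrier G; y \<in> carrier G; z \<in> carrier G\<rbrakk>
    \<Longrightarrow> lle G (x \<squnion>\<^bsub>order_of G\<^esub> y) z"
  using ord.join_le[of x z y] by simp

lemma lle_mult_inv_iff:
  assumes [simp]: "x \<in> carrier G" "y \<in> carrier G" "z \<in> carrier G"
  shows "lle G x (z \<otimes> inv y) \<longleftrightarrow> lle G (x \<otimes> y) z"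
  using mult_right_mono[of x "z \<otimes> inv y" y] mult_right_mono[of "x \<otimes> y" z "inv y"]
  by (auto simp: m_assoc)

lemma mult_inv_lle_iff:
  assumes [simp]: "x \<in> carrier G" "y \<in> carrier G" "z \<in> carrier G"
  shows "lle G (x \<otimes> inv y) z \<longleftrightarrow> lle G x (z \<otimes> y)"
  using mult_right_mono[of "x \<otimes> inv y" z y] mult_right_mono[of x "z \<otimes> y" "inv y"]
  by (auto simp: m_assoc)

lemma inv_mult_lle_iff:
  assumes [simp]: "x \<in> carrier G" "y \<in> carrier G" "z \<in> carrier G"
  shows "lle G (inv x \<otimes> y) z \<longleftrightarrow> lle G y (x \<otimes> z)"
  using mult_left_mono[of "inv x \<otimes> y" z x] mult_left_mono[of y "x \<otimes> z" "inv x"]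
  by (auto simp: m_assoc[symmetric])

text \<open>The excess over \<open>u [^] (n + 1)\<close>, multiplied by \<open>b\<close>, still lies
  below the excess over \<open>u [^] n\<close>. The step for \<open>n\<close> therefore uses the
  induction hypothesis at \<open>n + 1\<close>, so \<open>n\<close> stays arbitrary.\<close>

lemma pow_lle_excess:
  assumes [simp]: "f \<in> carrier G" "u \<in> carrier G" "b \<in> carrier G"
    and "lle G b u"
    and b_le: "\<And>n::nat. n \<ge> 1 \<Longrightarrow> lle G b (\<one> \<squnion>\<^bsub>order_of G\<^esub> (f \<otimes> inv (u [^] n)))"
    and "n \<ge> 1"
  shows "lle G (b [^] (k::nat)) (\<one> \<squnion>\<^bsub>order_of G\<^esub> (f \<otimes> inv (u [^] (n::nat))))"
  using \<open>n \<ge> 1\<close>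
proof (induction k arbitrary: n)
  case 0
  show ?case by (simp add: join_upper1)
next
  case (Suc k)
  define c where "c n = \<one> \<squnion>\<^bsub>order_of G\<^esub> (f \<otimes> inv (u [^] n))" for n :: nat
  have c [simp]: "c n \<in> carrier G" for n by (simp add: c_def)
  have "lle G (f \<otimes> inv (u [^] Suc n) \<otimes> b) (f \<otimes> inv (u [^] Suc n) \<otimes> u)"
    using \<open>lle G b u\<close> by (intro mult_left_mono) auto
  \<comment> \<open>Splitting the power as \<open>u \<otimes> u [^] n\<close> puts
    \<open>inv u\<close> last in the inverse, next to the trailing \<open>u\<close>, so the two
    cancel without commutativity.\<close>
  also have "f \<otimes> inv (u [^] Suc n) \<otimes> u = f \<otimes> inv (u [^] n)"
    by (subst nat_pow_Suc2) (simp_all add: inv_mult_group m_assoc)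
  finally have "lle G (f \<otimes> inv (u [^] Suc n) \<otimes> b) (c n)"
    by (rule lle_trans) (auto simp: c_def join_upper2)
  hence "lle G (f \<otimes> inv (u [^] Suc n)) (c n \<otimes> inv b)"
    by (subst lle_mult_inv_iff) auto
  \<comment> \<open>Both arguments of the join \<open>c (Suc n)\<close> need the bound
    \<open>c n \<otimes> inv b\<close>; for \<open>\<one>\<close> this is \<open>b_le\<close>
    rewritten.\<close>
  moreover have "lle G \<one> (c n \<otimes> inv b)"
    using b_le[OF Suc.prems] by (subst lle_mult_inv_iff) (auto simp: c_def)
  ultimately have "lle G (c (Suc n)) (c n \<otimes> inv b)"
    unfolding c_def[of "Suc n"] by (intro join_least) auto
  moreover have "lle G (b [^] k) (c (Suc n))"
    using Suc.IH[of "Suc n"] by (simp add: c_def)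
  ultimately have "lle G (b [^] k) (c n \<otimes> inv b)"
    by - (rule lle_trans[of "b [^] k" "c (Suc n)"], auto)
  thus ?case by (simp add: lle_mult_inv_iff c_def)
qed

end

context W_object
begin

lemma lle_if_truncates_lle:
  assumes [simp]: "f \<in> carrier G" "h \<in> carrier G"
    and bound: "\<And>n::nat. n \<ge> 1 \<Longrightarrow> lle G (f \<sqinter>\<^bsub>order_of G\<^esub> (wunit G [^] n)) h"
  shows "lle G f h"
proof -
  note [simp] = wunit_closed
  \<comment> \<open>Comparing \<open>f\<close> with this meet rather than with \<open>h\<close>
    makes \<open>a\<close> positive, and \<open>a = \<one>\<close> then gives \<open>f = g\<close>,
    which is below \<open>h\<close>.\<close>
  define g where "g = f \<sqinter>\<^bsub>order_of G\<^esub> h"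
  have g [simp]: "g \<in> carrier G" by (simp add: g_def)
  define a where "a = f \<otimes> inv g"
  have a [simp]: "a \<in> carrier G" by (simp add: a_def)
  define b where "b = a \<sqinter>\<^bsub>order_of G\<^esub> wunit G"
  have b [simp]: "b \<in> carrier G" by (simp add: b_def)
  have a_nonneg: "lle G \<one> a"
    by (simp add: a_def lle_mult_inv_iff) (simp add: g_def meet_lower1)
  have a_le: "lle G a (\<one> \<squnion>\<^bsub>order_of G\<^esub> (f \<otimes> inv (wunit G [^] n)))" if "n \<ge> 1" for n :: nat
  proof -
    \<comment> \<open>Dividing \<open>f\<close> on the left by \<open>c\<close> gives an element
      below both \<open>f\<close> and \<open>wunit G [^] n\<close>, hence below a truncate and so
      below \<open>h\<close> and \<open>g\<close>. From \<open>inv c \<otimes> f\<close> below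
      \<open>g\<close> it follows that \<open>a\<close> is below \<open>c\<close>.\<close>
    define c where "c = \<one> \<squnion>\<^bsub>order_of G\<^esub> (f \<otimes> inv (wunit G [^] n))"
    have c [simp]: "c \<in> carrier G" by (simp add: c_def)
    have "lle G \<one> c" "lle G (f \<otimes> inv (wunit G [^] n)) c"
      by (simp_all add: c_def join_upper)
    hence c_le: "lle G (inv c \<otimes> f) f" "lle G (inv c \<otimes> f) (wunit G [^] n)"
      using mult_right_mono[of \<one> c f] by (simp_all add: inv_mult_lle_iff mult_inv_lle_iff)
    hence "lle G (inv c \<otimes> f) (f \<sqinter>\<^bsub>order_of G\<^esub> (wunit G [^] n))"
      by (intro meet_greatest) auto
    hence "lle G (inv c \<otimes> f) h"
      using bound[OF that] by (rule lle_trans) auto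
    hence "lle G (inv c \<otimes> f) g"
      using c_le unfolding g_def by (intro meet_greatest) auto
    thus ?thesis by (simp add: a_def inv_mult_lle_iff mult_inv_lle_iff flip: c_def)
  qed
  have "lle G b a" "lle G b (wunit G)" by (simp_all add: b_def meet_lower)
  \<comment> \<open>The archimedean property asks for one bound valid for all \<open>k\<close>; the
    excess at index 1, the first truncation level, serves.\<close>
  have "lle G (b [^] k) (\<one> \<squnion>\<^bsub>order_of G\<^esub> (f \<otimes> inv (wunit G [^] (1::nat))))" for k :: nat
  proof (rule pow_lle_excess)
    show "lle G b (\<one> \<squnion>\<^bsub>order_of G\<^esub> (f \<otimes> inv (wunit G [^] n)))" if "n \<ge> 1" for n :: nat
      using \<open>lle G b a\<close> a_le[OF that] by (rule lle_trans) auto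
  qed (use \<open>lle G b (wunit G)\<close> in auto)
  moreover have "lle G \<one> b"
    using a_nonneg wunit_nonneg unfolding b_def by (intro meet_greatest) auto
  ultimately have "b = \<one>"
    by (intro archimedean[of b "\<one> \<squnion>\<^bsub>order_of G\<^esub> (f \<otimes> inv (wunit G [^] (1::nat)))"]) auto
  hence "a = \<one>"
    using wunit_weak[OF a a_nonneg] by (simp add: b_def)
  hence "f = \<one> \<otimes> g"
    unfolding a_def by (subst (asm) inv_solve_right') auto
  hence "f = g" by simp
  moreover have "lle G g h" by (simp add: g_def meet_lower2)
  ultimately show ?thesis by (rule ssubst)
qed

text \<open>This is the supremum claim inside one object; it is applied in each codomain
  \<open>H\<close> to the image \<open>\<theta> f\<close>.\<close>

lemma least_Upper_truncates:
  assumes [simp]: "f \<in> carrier G"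
  shows "least (order_of G) f
    (Upper (order_of G) {f \<sqinter>\<^bsub>order_of G\<^esub> (wunit G [^] n) | n :: nat. n \<ge> 1})"
proof (rule least_UpperI)
  show "le (order_of G) x f"
    if "x \<in> {f \<sqinter>\<^bsub>order_of G\<^esub> (wunit G [^] n) | n :: nat. n \<ge> 1}" for x
    using that by (auto simp: wunit_closed meet_lower1)
  show "le (order_of G) f h"
    if "h \<in> Upper (order_of G) {f \<sqinter>\<^bsub>order_of G\<^esub> (wunit G [^] n) | n :: nat. n \<ge> 1}" for h
  proof -
    have "lle G f h"
    proof (rule lle_if_truncates_lle)
      show "lle G (f \<sqinter>\<^bsub>order_of G\<^esub> (wunit G [^] n)) h" if "n \<ge> 1" for n :: nat
        using that \<open>h \<in> _\<close> by (auto simp: Upper_def wunit_closed)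
    qed (use that in \<open>auto simp: Upper_def\<close>)
    thus ?thesis by simp
  qed
qed (auto simp: wunit_closed)

end

theorem proposition5p2p1:
  fixes G :: "'a ulgroup" and f :: 'a
  assumes "W_object G" and "f \<in> carrier G"
  shows "pointwise_sup TYPE('h) G
           {f \<sqinter>\<^bsub>order_of G\<^esub> (wunit G [^]\<^bsub>G\<^esub> n) | n :: nat. n \<ge> 1} f"
proof -
  interpret G: W_object G by fact
  have "least (order_of H) (\<theta> f)
      (Upper (order_of H) (\<theta> ` {f \<sqinter>\<^bsub>order_of G\<^esub> (wunit G [^]\<^bsub>G\<^esub> n) | n :: nat. n \<ge> 1}))"
    if "W_object H" and \<theta>: "\<theta> \<in> W_hom G H" for H :: "'h ulgroup" and \<theta>
  proof -
    interpret H: W_object H by fact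
    interpret group_hom G H \<theta>
      using \<theta> by unfold_locales (simp add: W_hom_def)
    \<comment> \<open>\<open>\<theta>\<close> preserves meets and the unit, and as a group
      homomorphism also the powers of the unit.\<close>
    have "\<theta> (f \<sqinter>\<^bsub>order_of G\<^esub> (wunit G [^]\<^bsub>G\<^esub> n)) = \<theta> f \<sqinter>\<^bsub>order_of H\<^esub> (wunit H [^]\<^bsub>H\<^esub> n)"
      for n :: nat
      using \<theta> assms(2) by (simp add: W_hom_def G.wunit_closed hom_nat_pow)
    hence "\<theta> ` {f \<sqinter>\<^bsub>order_of G\<^esub> (wunit G [^]\<^bsub>G\<^esub> n) | n :: nat. n \<ge> 1}
        = {\<theta> f \<sqinter>\<^bsub>order_of H\<^esub> (wunit H [^]\<^bsub>H\<^esub> n) | n :: nat. n \<ge> 1}"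
      by (simp add: setcompr_eq_image image_image)
    thus ?thesis using H.least_Upper_truncates assms(2) by simp
  qed
  thus ?thesis
    using assms(2) by (auto simp: pointwise_sup_def G.wunit_closed)
qed

end
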